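(* In predicting the infinite time average of an observable $\hat A$, the mean square error (MSE) of the prediction of the Generalized Gibbs Ensemble based on an integral of motion $\hat I$, $$\mathrm{MSE}[\mathrm{Prediction}[\mathrm{Mean}_t[A]]]\equiv\mathrm{Var}_{\mathrm{GGE}}[\langle\alpha|\hat A|\alpha\rangle]=\frac{\sum_j\sum_{\alpha\in D\cap S_j}\bigl(\langle\alpha|\hat A|\alpha\rangle-\mathrm{Mean}_{\mathrm{GGE}|j}[A]\bigr)^2}{\sum_{\alpha\in D}1}$$ (where it is assumed that the initial states are uniformly distributed inside the microcanonical energy window), is bounded from above as $$\mathrm{Var}_{\mathrm{GGE}}[\langle\alpha|\hat A|\alpha\rangle]\ \le\ \mathrm{Var}_{\mathrm{MC}}[\langle\alpha|\hat A|\alpha\rangle]\left(\sin^2[\theta_{\hat I_{\mathrm{tl}},\,\hat{\hat P}_H\hat A_{\mathrm{tl}}}]+\bigl|\cos[\theta_{\hat I_{\mathrm{tl}},\,\hat{\hat P}_H\hat A_{\mathrm{tl}}}]\bigr|\,\underbrace{\mathcal O\!\left[\frac{\Delta I}{\sqrt{\mathrm{Var}_{\mathrm{MC}}[\langle\alpha|\hat I|\alpha\rangle]}}\right]}_{\ll 1}\right),$$ where $\theta_{\hat B_1,\hat B_2}$ is the Hilbert–Schmidt angle between observables $\hat B_1$ and $\hat B_2$, $\hat B_{\mathrm{tl}}$ is the traceless version of $\hat B$, $\hat{\hat P}_H$ is the super-operator that removes the off-diagonal matrix elements with respect to the basis of the eigenstates of the Hamiltonian $\hat H$, and $\Delta I\equiv\max_j(I_{j+1}-I_j)$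 is the maximal width of a microcanonical window for the additional integral of motion. The underbrace indicates that the correction term is an order-of-magnitude term, small compared with $1$.
   Context: Setting. $\hat H$ is a Hamiltonian with orthonormal eigenstates $|\alpha\rangle$ and energies $E_\alpha$. The energy axis is divided into narrow intervals, and one of them is the microcanonical window; $D$ is the set of indices $\alpha$ whose energy $E_\alpha$ lies in that interval, and $N_{\mathrm{MC}}=\sum_{\alpha\in D}1$ is the number of eigenstates in it. Observables are Hermitian operators acting within the $N_{\mathrm{MC}}$-dimensional space spanned by $\{|\alpha\rangle:\alpha\in D\}$. Integral of motion and tiling. An integral of motion $\hat I$ is an observable all of whose off-diagonal matrix elements in the basis $\{|\alpha\rangle\}$ are zero; $I_\alpha\equiv\langle\alpha|\hat I|\alpha\rangle$. The axis of values of $\hat I$ is tiled by a set of intervals $[I_j,I_{j+1}]$, and $S_j$ is the set of indices defined by $\alpha\in S_j\Leftrightarrow I_\alpha\in[I_j,I_{j+1}]$. Ensembles. The microcanonical mean and variance are $$\mathrm{Mean}_{\mathrm{MC}}[A]=\frac{1}{N_{\mathrm{MC}}}\sum_{\alpha\in D}\langle\alpha|\hat A|\alpha\rangle,\qquad \mathrm{Var}_{\mathrm{MC}}[\langle\alpha|\hat A|\alpha\rangle]=\frac{1}{N_{\mathrm{MC}}}\sum_{\alpha\in D}\bigl(\langle\alpha|\hat A|\alpha\rangle-\mathrm{Mean}_{\mathrm{MC}}[A]\bigr)^2,$$ and similarly for $\hat I$. The (minimal, microcanonical version of the) Generalized Gibbs Ensemble consists of the states with $\alpha\in D\cap S_j$,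 taken with equal probability; its prediction for the infinite time average $\mathrm{Mean}_t[A]$ of the quantum-mechanical mean of $\hat A$, when the initial state is known to lie in the $j$-th interval of $\hat I$, is $$\mathrm{Mean}_{\mathrm{GGE}|j}[A]=\frac{\sum_{\alpha\in D\cap S_j}\langle\alpha|\hat A|\alpha\rangle}{\sum_{\alpha\in D\cap S_j}1}.$$ Hilbert–Schmidt geometry. The inner product is $(\hat B_1|\hat B_2)=\mathrm{Tr}[\hat B_1^\dagger\hat B_2]$, with norm $\|\hat B\|=\sqrt{(\hat B|\hat B)}$; the angle $\theta_{\hat B_1,\hat B_2}\in[0,\pi]$ is given by $\cos\theta_{\hat B_1,\hat B_2}=(\hat B_1|\hat B_2)/(\|\hat B_1\|\,\|\hat B_2\|)$. The traceless version of an observable $\hat B$ is $\hat B_{\mathrm{tl}}\equiv\hat B-\mathrm{Tr}[\hat B]/N_{\mathrm{MC}}$ (the number being understood as a multiple of the identity).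
   Formalization: The intervals tiling the axis of values of I are taken as disjoint, each common endpoint belonging to at most one of them; with all intervals closed, a value at a common endpoint would be counted in two sets S_j and the inequality can fail. *)

theory Defs
  imports "HOL-Analysis.Analysis" "HOL-Library.Landau_Symbols"
begin

class complex_vector = ab_group_add +
  fixes scaleC :: "complex \<Rightarrow> 'a \<Rightarrow> 'a"  (infixr "*\<^sub>C" 75)
  assumes scaleC_add_right: "c *\<^sub>C (x + y) = c *\<^sub>C x + c *\<^sub>C y"
    and scaleC_add_left: "(c + d) *\<^sub>C x = c *\<^sub>C x + d *\<^sub>C x"
    and scaleC_scaleC: "c *\<^sub>C d *\<^sub>C x = (c * d) *\<^sub>C x"
    and scaleC_one: "1 *\<^sub>C x = x"

lemma vector_space_scaleC:
  "vector_space (scaleC :: complex \<Rightarrow> 'a \<Rightarrow> 'a::complex_vector)"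
  by unfold_locales
    (simp_all add: scaleC_add_right scaleC_add_left scaleC_scaleC scaleC_one)

abbreviation cspan :: "'a::complex_vector set \<Rightarrow> 'a set"
  where "cspan \<equiv> module.span scaleC"

abbreviation csubspace :: "'a::complex_vector set \<Rightarrow> bool"
  where "csubspace \<equiv> module.subspace scaleC"

text \<open>The physicists' convention: the inner product is linear in the second argument.
  Completeness is not required.\<close>

class complex_inner = complex_vector +
  fixes cinner :: "'a \<Rightarrow> 'a \<Rightarrow> complex"
  assumes cinner_commute: "cinner x y = cnj (cinner y x)"
    and cinner_add_right: "cinner x (y + z) = cinner x y + cinner x z"
    and cinner_scaleC_right: "cinner x (c *\<^sub>C y) = c * cinner x y"
    and cinner_ge_zero: "0 \<le> Re (cinner x x)"
    and cinner_eq_zero_iff: "cinner x x = 0 \<longleftrightarrow> x = 0"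

definition clinear_on :: "'a::complex_vector set \<Rightarrow> ('a \<Rightarrow> 'a) \<Rightarrow> bool" where
  "clinear_on V B \<longleftrightarrow>
     (\<forall>x\<in>V. \<forall>y\<in>V. B (x + y) = B x + B y) \<and> (\<forall>c. \<forall>x\<in>V. B (c *\<^sub>C x) = c *\<^sub>C B x)"

definition hermitian_on :: "'a::complex_inner set \<Rightarrow> ('a \<Rightarrow> 'a) \<Rightarrow> bool" where
  "hermitian_on V B \<longleftrightarrow> (\<forall>x\<in>V. \<forall>y\<in>V. cinner (B x) y = cinner x (B y))"

text \<open>The Hamiltonian may be unbounded, hence the explicit domain \<open>V\<close>.\<close>

definition hamiltonian :: "'a::complex_inner set \<Rightarrow> ('a \<Rightarrow> 'a) \<Rightarrow> bool" where
  "hamiltonian V H \<longleftrightarrow> csubspace V \<and> clinear_on V H \<and> hermitian_on V H"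

definition orthonormal_eigenstates ::
  "'a::complex_inner set \<Rightarrow> ('a \<Rightarrow> 'a) \<Rightarrow> 'i set \<Rightarrow> ('i \<Rightarrow> 'a) \<Rightarrow> ('i \<Rightarrow> real) \<Rightarrow> bool" where
  "orthonormal_eigenstates V H K \<psi> E \<longleftrightarrow>
     (\<forall>\<alpha>\<in>K. \<psi> \<alpha> \<in> V \<and> H (\<psi> \<alpha>) = complex_of_real (E \<alpha>) *\<^sub>C \<psi> \<alpha>) \<and>
     (\<forall>\<alpha>\<in>K. \<forall>\<beta>\<in>K. cinner (\<psi> \<alpha>) (\<psi> \<beta>) = (if \<alpha> = \<beta> then 1 else 0))"

definition window :: "('i \<Rightarrow> 'a::complex_inner) \<Rightarrow> 'i set \<Rightarrow> 'a set" where
  "window \<psi> D = cspan (\<psi> ` D)"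

text \<open>Operators acting within the window are functions on the whole type of which only the
  restriction to the window matters.\<close>

definition observable :: "('i \<Rightarrow> 'a::complex_inner) \<Rightarrow> 'i set \<Rightarrow> ('a \<Rightarrow> 'a) \<Rightarrow> bool" where
  "observable \<psi> D B \<longleftrightarrow>
     B ` window \<psi> D \<subseteq> window \<psi> D \<and> clinear_on (window \<psi> D) B \<and> hermitian_on (window \<psi> D) B"

definition integral_of_motion :: "('i \<Rightarrow> 'a::complex_inner) \<Rightarrow> 'i set \<Rightarrow> ('a \<Rightarrow> 'a) \<Rightarrow> bool" where
  "integral_of_motion \<psi> D I \<longleftrightarrow> observable \<psi> D I \<and>
     (\<forall>\<alpha>\<in>D. \<forall>\<beta>\<in>D. \<alpha> \<noteq> \<beta> \<longrightarrow> cinner (\<psi> \<alpha>) (I (\<psi> \<beta>)) = 0)"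

text \<open>Diagonal matrix elements of a Hermitian operator are real, so \<open>Re\<close> loses nothing.\<close>

definition diag_elem :: "('i \<Rightarrow> 'a::complex_inner) \<Rightarrow> ('a \<Rightarrow> 'a) \<Rightarrow> 'i \<Rightarrow> real" where
  "diag_elem \<psi> B \<alpha> = Re (cinner (\<psi> \<alpha>) (B (\<psi> \<alpha>)))"

definition Mean_MC :: "('i \<Rightarrow> 'a::complex_inner) \<Rightarrow> 'i set \<Rightarrow> ('a \<Rightarrow> 'a) \<Rightarrow> real" where
  "Mean_MC \<psi> D B = (\<Sum>\<alpha>\<in>D. diag_elem \<psi> B \<alpha>) / real (card D)"

definition Var_MC :: "('i \<Rightarrow> 'a::complex_inner) \<Rightarrow> 'i set \<Rightarrow> ('a \<Rightarrow> 'a) \<Rightarrow> real" where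
  "Var_MC \<psi> D B = (\<Sum>\<alpha>\<in>D. (diag_elem \<psi> B \<alpha> - Mean_MC \<psi> D B)\<^sup>2) / real (card D)"

text \<open>The tile \<open>T j\<close> is the interval from \<open>b j\<close> to \<open>b (j + 1)\<close>. With both endpoints included,
  neighbouring tiles would overlap and a value equal to a common endpoint would be counted twice;
  so each endpoint may or may not belong to \<open>T j\<close>, and the tiles are required to be disjoint.
  The set \<open>J\<close> of tile labels may be finite or infinite.\<close>

definition tiling :: "int set \<Rightarrow> (int \<Rightarrow> real) \<Rightarrow> (int \<Rightarrow> real set) \<Rightarrow> real set \<Rightarrow> bool" where
  "tiling J b T X \<longleftrightarrow>
     (\<forall>j\<in>J. b j < b (j + 1) \<and> {b j<..<b (j + 1)} \<subseteq> T j \<and> T j \<subseteq> {b j..b (j + 1)}) \<and>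
     disjoint_family_on T J \<and> X \<subseteq> (\<Union>j\<in>J. T j)"

text \<open>The supremum is the maximum whenever the latter exists, e.g. for finite \<open>J\<close>.\<close>

definition max_width :: "int set \<Rightarrow> (int \<Rightarrow> real) \<Rightarrow> real" where
  "max_width J b = (SUP j\<in>J. b (j + 1) - b j)"

definition tile_states ::
  "('i \<Rightarrow> 'a::complex_inner) \<Rightarrow> ('a \<Rightarrow> 'a) \<Rightarrow> (int \<Rightarrow> real set) \<Rightarrow> int \<Rightarrow> 'i set" where
  "tile_states \<psi> I T j = {\<alpha>. diag_elem \<psi> I \<alpha> \<in> T j}"

definition Mean_GGE ::
  "('i \<Rightarrow> 'a::complex_inner) \<Rightarrow> 'i set \<Rightarrow> ('a \<Rightarrow> 'a) \<Rightarrow> (int \<Rightarrow> real set) \<Rightarrow> int \<Rightarrow> ('a \<Rightarrow> 'a) \<Rightarrow> real"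
  where
  "Mean_GGE \<psi> D I T j A =
     (\<Sum>\<alpha>\<in>D \<inter> tile_states \<psi> I T j. diag_elem \<psi> A \<alpha>) / real (card (D \<inter> tile_states \<psi> I T j))"

text \<open>By definition, this is also the mean square error of the prediction of the Generalized
  Gibbs Ensemble for the infinite time average of \<open>A\<close>. The outer sum has finitely many nonzero
  terms when \<open>D\<close> is finite and the tiles are disjoint.\<close>

definition Var_GGE ::
  "('i \<Rightarrow> 'a::complex_inner) \<Rightarrow> 'i set \<Rightarrow> ('a \<Rightarrow> 'a) \<Rightarrow> int set \<Rightarrow> (int \<Rightarrow> real set) \<Rightarrow> ('a \<Rightarrow> 'a) \<Rightarrow> real"
  where
  "Var_GGE \<psi> D I J T A =
     (\<Sum>\<^sub>\<infinity>j\<in>J. \<Sum>\<alpha>\<in>D \<inter> tile_states \<psi> I T j. (diag_elem \<psi> A \<alpha> - Mean_GGE \<psi> D I T j A)\<^sup>2)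
       / real (card D)"

definition op_trace :: "('i \<Rightarrow> 'a::complex_inner) \<Rightarrow> 'i set \<Rightarrow> ('a \<Rightarrow> 'a) \<Rightarrow> complex" where
  "op_trace \<psi> D B = (\<Sum>\<alpha>\<in>D. cinner (\<psi> \<alpha>) (B (\<psi> \<alpha>)))"

text \<open>The adjoint within the window, unique there because the window is finite-dimensional.\<close>

definition op_adjoint :: "('i \<Rightarrow> 'a::complex_inner) \<Rightarrow> 'i set \<Rightarrow> ('a \<Rightarrow> 'a) \<Rightarrow> 'a \<Rightarrow> 'a" where
  "op_adjoint \<psi> D B x =
     (THE z. z \<in> window \<psi> D \<and> (\<forall>y\<in>window \<psi> D. cinner z y = cinner x (B y)))"

definition hs_inner ::
  "('i \<Rightarrow> 'a::complex_inner) \<Rightarrow> 'i set \<Rightarrow> ('a \<Rightarrow> 'a) \<Rightarrow> ('a \<Rightarrow> 'a) \<Rightarrow> complex" where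
  "hs_inner \<psi> D B1 B2 = op_trace \<psi> D (op_adjoint \<psi> D B1 \<circ> B2)"

definition hs_norm :: "('i \<Rightarrow> 'a::complex_inner) \<Rightarrow> 'i set \<Rightarrow> ('a \<Rightarrow> 'a) \<Rightarrow> real" where
  "hs_norm \<psi> D B = sqrt (Re (hs_inner \<psi> D B B))"

text \<open>For observables (Hermitian operators) the inner product is real.\<close>

definition hs_angle ::
  "('i \<Rightarrow> 'a::complex_inner) \<Rightarrow> 'i set \<Rightarrow> ('a \<Rightarrow> 'a) \<Rightarrow> ('a \<Rightarrow> 'a) \<Rightarrow> real" where
  "hs_angle \<psi> D B1 B2 =
     arccos (Re (hs_inner \<psi> D B1 B2) / (hs_norm \<psi> D B1 * hs_norm \<psi> D B2))"

definition traceless :: "('i \<Rightarrow> 'a::complex_inner) \<Rightarrow> 'i set \<Rightarrow> ('a \<Rightarrow> 'a) \<Rightarrow> 'a \<Rightarrow> 'a" where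
  "traceless \<psi> D B x = B x - (op_trace \<psi> D B / of_nat (card D)) *\<^sub>C x"

text \<open>In bra-ket notation, the sum over \<open>\<alpha>\<close> in \<open>D\<close> of \<open>|\<alpha>\<rangle>\<langle>\<alpha>|B|\<alpha>\<rangle>\<langle>\<alpha>|\<close>.\<close>

definition diag_part :: "('i \<Rightarrow> 'a::complex_inner) \<Rightarrow> 'i set \<Rightarrow> ('a \<Rightarrow> 'a) \<Rightarrow> 'a \<Rightarrow> 'a" where
  "diag_part \<psi> D B x =
     (\<Sum>\<alpha>\<in>D. (cinner (\<psi> \<alpha>) (B (\<psi> \<alpha>)) * cinner (\<psi> \<alpha>) x) *\<^sub>C \<psi> \<alpha>)"

end

theory Submission
  imports Defs
begin

text \<open>Centre the diagonal elements of \<open>A\<close> and \<open>I\<close> to obtain real vectors \<open>u\<close> and \<open>w\<close> indexed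
  by \<open>D\<close>; the Hilbert-Schmidt angle in the bound is the Euclidean angle between \<open>w\<close> and \<open>u\<close>.
  Cell means are the best approximation of \<open>u\<close> by functions constant on the tiles, so the ensemble
  error is at most the squared distance from \<open>u\<close> to \<open>c v\<close>, where \<open>c w\<close> is the orthogonal projection
  of \<open>u\<close> onto \<open>w\<close> and \<open>v\<close> replaces each entry of \<open>w\<close> by the (shifted) left endpoint of its tile.
  By Minkowski that distance is at most \<open>|u - c w| + |c| |w - v|\<close>, i.e.
  \<open>|u| (|sin \<theta>| + |cos \<theta>| \<epsilon>)\<close> with \<open>\<epsilon> = \<Delta>I / sqrt Var I\<close>.
  Squaring gives the claim with \<open>g \<epsilon> = 2 \<epsilon> + \<epsilon>\<^sup>2\<close>.\<close>

section \<open>Linear algebra over the complex scalars and sesquilinearity of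
  \<open>cinner\<close>\<close>

interpretation C: vector_space "scaleC :: complex \<Rightarrow> 'a \<Rightarrow> 'a::complex_vector"
  by (rule vector_space_scaleC)

lemma cinner_add_left: "cinner (x + y) z = cinner x z + cinner (y :: 'a::complex_inner) z"
  by (metis cinner_add_right cinner_commute complex_cnj_add)

lemma cinner_scaleC_left: "cinner (c *\<^sub>C x) (y :: 'a::complex_inner) = cnj c * cinner x y"
  by (metis cinner_commute cinner_scaleC_right complex_cnj_mult)

lemma cinner_zero_right [simp]: "cinner x (0 :: 'a::complex_inner) = 0"
  using cinner_add_right[of x 0 0] by simp

lemma cinner_zero_left [simp]: "cinner (0 :: 'a::complex_inner) x = 0"
  using cinner_add_left[of 0 0 x] by simp

lemma cinner_diff_right: "cinner x (y - z) = cinner x y - cinner x (z :: 'a::complex_inner)"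
  using cinner_add_right[of x "y - z" z] by simp

lemma cinner_diff_left: "cinner (x - y) z = cinner x z - cinner (y :: 'a::complex_inner) z"
  using cinner_add_left[of "x - y" y z] by simp

lemma cinner_sum_right: "cinner x (\<Sum>i\<in>S. f i) = (\<Sum>i\<in>S. cinner x (f i :: 'a::complex_inner))"
  by (induction S rule: infinite_finite_induct) (auto simp: cinner_add_right)

lemma cinner_sum_left: "cinner (\<Sum>i\<in>S. f i) x = (\<Sum>i\<in>S. cinner (f i :: 'a::complex_inner) x)"
  by (induction S rule: infinite_finite_induct) (auto simp: cinner_add_left)

section \<open>Diagonal operators and their Hilbert-Schmidt geometry in a finite orthonormal
  window\<close>

locale orthonormal_window =
  fixes \<psi> :: "'i \<Rightarrow> 'a::complex_inner" and D :: "'i set"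
  assumes fin: "finite D"
    and orth: "\<And>\<alpha> \<beta>. \<alpha> \<in> D \<Longrightarrow> \<beta> \<in> D \<Longrightarrow> cinner (\<psi> \<alpha>) (\<psi> \<beta>) = (if \<alpha> = \<beta> then 1 else 0)"
begin

lemma subspace_window: "csubspace (window \<psi> D)"
  unfolding window_def by (rule C.subspace_span)

lemma state_in_window: "\<alpha> \<in> D \<Longrightarrow> \<psi> \<alpha> \<in> window \<psi> D"
  unfolding window_def by (intro C.span_base imageI)

text \<open>Induction over the span reduces this to adding one multiple of a basis state, for which
  orthonormality leaves a single summand.\<close>

lemma window_expansion:
  assumes "x \<in> window \<psi> D"
  shows "x = (\<Sum>\<beta>\<in>D. cinner (\<psi> \<beta>) x *\<^sub>C \<psi> \<beta>)"
  using assms unfolding window_def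
proof (induction rule: C.span_induct_alt)
  case base
  show ?case by simp
next
  case (step c x y)
  then obtain \<alpha> where \<alpha>: "\<alpha> \<in> D" "x = \<psi> \<alpha>" by blast
  have "(\<Sum>\<beta>\<in>D. (c * cinner (\<psi> \<beta>) (\<psi> \<alpha>)) *\<^sub>C \<psi> \<beta>) = (\<Sum>\<beta>\<in>D. if \<beta> = \<alpha> then c *\<^sub>C \<psi> \<alpha> else 0)"
    by (rule sum.cong) (use \<alpha> orth in auto)
  also have "\<dots> = c *\<^sub>C \<psi> \<alpha>"
    using \<alpha> fin by simp
  finally show ?case
    using step.IH \<alpha>
    by (simp add: cinner_add_right cinner_scaleC_right C.scale_left_distrib sum.distrib)
qed

text \<open>\<open>B x\<close> meets the description under \<open>THE\<close>. Any other candidate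
  differs from it by a window vector orthogonal to the whole window, in particular to itself, hence
  by zero.\<close>

lemma op_adjoint_hermitian:
  assumes "B ` window \<psi> D \<subseteq> window \<psi> D" "hermitian_on (window \<psi> D) B" "x \<in> window \<psi> D"
  shows "op_adjoint \<psi> D B x = B x"
  unfolding op_adjoint_def
proof (rule the_equality)
  show "B x \<in> window \<psi> D \<and> (\<forall>y\<in>window \<psi> D. cinner (B x) y = cinner x (B y))"
    using assms unfolding hermitian_on_def by blast
next
  fix z assume z: "z \<in> window \<psi> D \<and> (\<forall>y\<in>window \<psi> D. cinner z y = cinner x (B y))"
  have mem: "z - B x \<in> window \<psi> D"
    using z assms C.subspace_diff[OF subspace_window] by blast
  have "cinner (z - B x) (z - B x) = 0"
    using z mem assms unfolding hermitian_on_def by (simp add: cinner_diff_left)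
  thus "z = B x"
    by (simp add: cinner_eq_zero_iff)
qed

text \<open>Turns Hilbert-Schmidt products into Euclidean ones: the adjoint moves to the left slot
  as \<open>B\<close>, after which both operators act on \<open>\<psi> \<alpha>\<close> by real
  scalars.\<close>

lemma hs_inner_diagonal:
  assumes B: "B ` window \<psi> D \<subseteq> window \<psi> D" "hermitian_on (window \<psi> D) B"
    and r: "\<And>\<alpha>. \<alpha> \<in> D \<Longrightarrow> B (\<psi> \<alpha>) = complex_of_real (r \<alpha>) *\<^sub>C \<psi> \<alpha>"
    and s: "\<And>\<alpha>. \<alpha> \<in> D \<Longrightarrow> C (\<psi> \<alpha>) = complex_of_real (s \<alpha>) *\<^sub>C \<psi> \<alpha>"
  shows "hs_inner \<psi> D B C = complex_of_real (\<Sum>\<alpha>\<in>D. r \<alpha> * s \<alpha>)"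
proof -
  have "cinner (\<psi> \<alpha>) (op_adjoint \<psi> D B (C (\<psi> \<alpha>))) = complex_of_real (r \<alpha> * s \<alpha>)" if "\<alpha> \<in> D" for \<alpha>
  proof -
    have Cw: "C (\<psi> \<alpha>) \<in> window \<psi> D"
      using s that state_in_window C.subspace_scale[OF subspace_window] by simp
    have "cinner (\<psi> \<alpha>) (op_adjoint \<psi> D B (C (\<psi> \<alpha>))) = cinner (B (\<psi> \<alpha>)) (C (\<psi> \<alpha>))"
      using op_adjoint_hermitian[OF B Cw] B(2) Cw state_in_window[OF that]
      unfolding hermitian_on_def by simp
    thus ?thesis
      using that by (simp add: r s cinner_scaleC_left cinner_scaleC_right orth)
  qed
  thus ?thesis
    by (simp add: hs_inner_def op_trace_def)
qed

lemma observable_diag_real: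
  assumes "observable \<psi> D B" "\<alpha> \<in> D"
  shows "cinner (\<psi> \<alpha>) (B (\<psi> \<alpha>)) = complex_of_real (diag_elem \<psi> B \<alpha>)"
proof -
  have "cinner (\<psi> \<alpha>) (B (\<psi> \<alpha>)) = cnj (cinner (\<psi> \<alpha>) (B (\<psi> \<alpha>)))"
    using assms state_in_window unfolding observable_def hermitian_on_def
    by (metis cinner_commute)
  thus ?thesis
    unfolding diag_elem_def by (metis Reals_cnj_iff of_real_Re)
qed

lemma traceless_observable:
  assumes "observable \<psi> D B"
  shows "traceless \<psi> D B x = B x - complex_of_real (Mean_MC \<psi> D B) *\<^sub>C x"
  using assms by (simp add: traceless_def op_trace_def Mean_MC_def observable_diag_real)

lemma traceless_closed:
  assumes "observable \<psi> D B"
  shows "traceless \<psi> D B ` window \<psi> D \<subseteq> window \<psi> D"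
proof -
  have "B x \<in> window \<psi> D" if "x \<in> window \<psi> D" for x
    using assms that unfolding observable_def by blast
  thus ?thesis
    by (auto simp: traceless_def
        intro!: C.subspace_diff[OF subspace_window] C.subspace_scale[OF subspace_window])
qed

lemma traceless_hermitian:
  assumes "observable \<psi> D B"
  shows "hermitian_on (window \<psi> D) (traceless \<psi> D B)"
  using assms unfolding hermitian_on_def traceless_observable[OF assms]
  by (auto simp: observable_def hermitian_on_def cinner_diff_left cinner_diff_right
      cinner_scaleC_left cinner_scaleC_right)

text \<open>Since \<open>I\<close> maps the window into itself, \<open>I (\<psi> \<alpha>)\<close>
  can be expanded in the basis, and the vanishing off-diagonal elements leave only the term at
  \<alpha>.\<close>

lemma integral_of_motion_eigen:
  assumes I: "integral_of_motion \<psi> D I" and \<alpha>: "\<alpha> \<in> D"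
  shows "I (\<psi> \<alpha>) = complex_of_real (diag_elem \<psi> I \<alpha>) *\<^sub>C \<psi> \<alpha>"
proof -
  have obs: "observable \<psi> D I"
    and off: "\<And>\<beta>. \<beta> \<in> D \<Longrightarrow> \<beta> \<noteq> \<alpha> \<Longrightarrow> cinner (\<psi> \<beta>) (I (\<psi> \<alpha>)) = 0"
    using I \<alpha> unfolding integral_of_motion_def by auto
  have "I (\<psi> \<alpha>) \<in> window \<psi> D"
    using obs state_in_window[OF \<alpha>] unfolding observable_def by blast
  hence "I (\<psi> \<alpha>) = (\<Sum>\<beta>\<in>D. cinner (\<psi> \<beta>) (I (\<psi> \<alpha>)) *\<^sub>C \<psi> \<beta>)"
    by (rule window_expansion)
  also have "\<dots> = (\<Sum>\<beta>\<in>D. if \<beta> = \<alpha> then complex_of_real (diag_elem \<psi> I \<alpha>) *\<^sub>C \<psi> \<alpha> else 0)"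
    by (rule sum.cong) (use off \<alpha> obs in \<open>auto simp: observable_diag_real\<close>)
  also have "\<dots> = complex_of_real (diag_elem \<psi> I \<alpha>) *\<^sub>C \<psi> \<alpha>"
    using \<alpha> fin by simp
  finally show ?thesis .
qed

lemma traceless_eigen:
  assumes "integral_of_motion \<psi> D I" "\<alpha> \<in> D"
  shows "traceless \<psi> D I (\<psi> \<alpha>) = complex_of_real (diag_elem \<psi> I \<alpha> - Mean_MC \<psi> D I) *\<^sub>C \<psi> \<alpha>"
proof -
  have "observable \<psi> D I"
    using assms unfolding integral_of_motion_def by blast
  thus ?thesis
    by (simp add: traceless_observable integral_of_motion_eigen[OF assms] C.scale_left_diff_distrib)
qed

lemma diag_part_closed: "diag_part \<psi> D B ` window \<psi> D \<subseteq> window \<psi> D"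
  by (auto simp: diag_part_def state_in_window
      intro!: C.subspace_sum[OF subspace_window] C.subspace_scale[OF subspace_window])

lemma diag_part_state:
  assumes "\<alpha> \<in> D"
  shows "diag_part \<psi> D B (\<psi> \<alpha>) = cinner (\<psi> \<alpha>) (B (\<psi> \<alpha>)) *\<^sub>C \<psi> \<alpha>"
proof -
  have "diag_part \<psi> D B (\<psi> \<alpha>)
      = (\<Sum>\<beta>\<in>D. if \<beta> = \<alpha> then cinner (\<psi> \<alpha>) (B (\<psi> \<alpha>)) *\<^sub>C \<psi> \<alpha> else 0)"
    unfolding diag_part_def by (rule sum.cong) (use assms orth in auto)
  thus ?thesis
    using assms fin by simp
qed

text \<open>Real weights are unaffected by conjugation, so each rank-one term is symmetric on
  arbitrary vectors; hence the arbitrary set \<open>S\<close>.\<close>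

lemma diag_part_hermitian:
  assumes "\<And>\<alpha>. \<alpha> \<in> D \<Longrightarrow> cinner (\<psi> \<alpha>) (B (\<psi> \<alpha>)) \<in> \<real>"
  shows "hermitian_on S (diag_part \<psi> D B)"
  unfolding hermitian_on_def diag_part_def
proof (intro ballI)
  fix x y
  have "cnj (cinner (\<psi> \<alpha>) (B (\<psi> \<alpha>)) * cinner (\<psi> \<alpha>) x) * cinner (\<psi> \<alpha>) y
      = cinner (\<psi> \<alpha>) (B (\<psi> \<alpha>)) * cinner (\<psi> \<alpha>) y * cinner x (\<psi> \<alpha>)" if "\<alpha> \<in> D" for \<alpha>
    using assms[OF that] cinner_commute[of x "\<psi> \<alpha>"]
    by (simp add: Reals_cnj_iff)
  thus "cinner (\<Sum>\<alpha>\<in>D. (cinner (\<psi> \<alpha>) (B (\<psi> \<alpha>)) * cinner (\<psi> \<alpha>) x) *\<^sub>C \<psi> \<alpha>) y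
      = cinner x (\<Sum>\<alpha>\<in>D. (cinner (\<psi> \<alpha>) (B (\<psi> \<alpha>)) * cinner (\<psi> \<alpha>) y) *\<^sub>C \<psi> \<alpha>)"
    unfolding cinner_sum_left cinner_sum_right cinner_scaleC_left cinner_scaleC_right
    by (intro sum.cong refl) auto
qed

lemma traceless_diag:
  assumes "observable \<psi> D B" "\<alpha> \<in> D"
  shows "cinner (\<psi> \<alpha>) (traceless \<psi> D B (\<psi> \<alpha>)) = complex_of_real (diag_elem \<psi> B \<alpha> - Mean_MC \<psi> D B)"
  using assms
  by (simp add: traceless_observable cinner_diff_right cinner_scaleC_right observable_diag_real orth)

text \<open>Both operators are diagonal with real entries, \<open>w\<close> and \<open>u\<close>, so
  the angle is that of two real vectors and the remaining estimate can be done in Euclidean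
  space.\<close>

lemma hs_angle_integral_of_motion:
  assumes A: "observable \<psi> D A" and I: "integral_of_motion \<psi> D I"
  defines "u \<equiv> \<lambda>\<alpha>. diag_elem \<psi> A \<alpha> - Mean_MC \<psi> D A"
    and "w \<equiv> \<lambda>\<alpha>. diag_elem \<psi> I \<alpha> - Mean_MC \<psi> D I"
  shows "hs_angle \<psi> D (traceless \<psi> D I) (diag_part \<psi> D (traceless \<psi> D A))
    = arccos ((\<Sum>\<alpha>\<in>D. w \<alpha> * u \<alpha>) / (L2_set w D * L2_set u D))"
proof -
  have obs: "observable \<psi> D I"
    using I unfolding integral_of_motion_def by blast
  have wI: "traceless \<psi> D I (\<psi> \<alpha>) = complex_of_real (w \<alpha>) *\<^sub>C \<psi> \<alpha>" if "\<alpha> \<in> D" for \<alpha>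
    using traceless_eigen[OF I that] by (simp add: w_def)
  have uA: "diag_part \<psi> D (traceless \<psi> D A) (\<psi> \<alpha>) = complex_of_real (u \<alpha>) *\<^sub>C \<psi> \<alpha>"
    if "\<alpha> \<in> D" for \<alpha>
    using that A by (simp add: diag_part_state traceless_diag u_def)
  have herm: "hermitian_on (window \<psi> D) (diag_part \<psi> D (traceless \<psi> D A))"
    by (rule diag_part_hermitian) (simp add: traceless_diag[OF A])
  note hsI = hs_inner_diagonal[OF traceless_closed[OF obs] traceless_hermitian[OF obs] wI]
  show ?thesis
    by (simp add: hs_angle_def hs_norm_def L2_set_def power2_eq_square
        hsI[OF _ wI] hsI[OF _ uA] hs_inner_diagonal[OF diag_part_closed herm uA uA])
qed

end

section \<open>Least-squares optimality of the tile means\<close>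

lemma sum_squares_mean_minimal:
  fixes a :: "'i \<Rightarrow> real"
  assumes "finite S"
  shows "(\<Sum>\<alpha>\<in>S. (a \<alpha> - (\<Sum>\<beta>\<in>S. a \<beta>) / real (card S))\<^sup>2) \<le> (\<Sum>\<alpha>\<in>S. (a \<alpha> - x)\<^sup>2)"
proof (cases "S = {}")
  case False
  define m where "m = (\<Sum>\<beta>\<in>S. a \<beta>) / real (card S)"
  \<comment> \<open>This kills the cross term in the expansion about \<open>m\<close>; the excess
    left is \<open>real (card S) * (m - x)\<^sup>2\<close>.\<close>
  have "(\<Sum>\<alpha>\<in>S. a \<alpha> - m) = 0"
    using False assms by (simp add: m_def sum_subtractf)
  moreover have "(\<Sum>\<alpha>\<in>S. (a \<alpha> - x)\<^sup>2)
      = (\<Sum>\<alpha>\<in>S. (a \<alpha> - m)\<^sup>2 + 2 * (m - x) * (a \<alpha> - m) + (m - x)\<^sup>2)"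
    by (intro sum.cong refl) (simp add: power2_eq_square algebra_simps)
  ultimately have "(\<Sum>\<alpha>\<in>S. (a \<alpha> - x)\<^sup>2) = (\<Sum>\<alpha>\<in>S. (a \<alpha> - m)\<^sup>2) + real (card S) * (m - x)\<^sup>2"
    by (simp add: sum.distrib flip: sum_distrib_left)
  thus ?thesis
    by (simp add: m_def)
qed simp

text \<open>On each tile the mean is replaced by a worse constant, and the sum over tiles is
  regrouped into a sum over states. The labelling \<open>cell\<close> is fixed before
  \<open>h\<close>, so that \<open>h\<close> may be chosen freely afterwards.\<close>

lemma Var_GGE_le_tilewise_constant:
  assumes "finite D" and tiling: "tiling J b T (diag_elem \<psi> I ` D)"
  obtains cell where "\<And>\<alpha>. \<alpha> \<in> D \<Longrightarrow> cell \<alpha> \<in> J \<and> diag_elem \<psi> I \<alpha> \<in> T (cell \<alpha>)"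
    and "\<And>h. Var_GGE \<psi> D I J T A \<le> (\<Sum>\<alpha>\<in>D. (diag_elem \<psi> A \<alpha> - h (cell \<alpha>))\<^sup>2) / real (card D)"
proof -
  let ?S = "\<lambda>j. D \<inter> tile_states \<psi> I T j"
  have "\<forall>\<alpha>\<in>D. \<exists>j\<in>J. diag_elem \<psi> I \<alpha> \<in> T j"
    using tiling unfolding tiling_def by blast
  then obtain cell where cell: "\<And>\<alpha>. \<alpha> \<in> D \<Longrightarrow> cell \<alpha> \<in> J \<and> diag_elem \<psi> I \<alpha> \<in> T (cell \<alpha>)"
    by metis
  \<comment> \<open>Disjointness of the tiles makes the label of a state unique.\<close>
  have S: "?S j = {\<alpha>\<in>D. cell \<alpha> = j}" if "j \<in> J" for j
    using cell that tiling unfolding tiling_def disjoint_family_on_def tile_states_def by blast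
  have "Var_GGE \<psi> D I J T A \<le> (\<Sum>\<alpha>\<in>D. (diag_elem \<psi> A \<alpha> - h (cell \<alpha>))\<^sup>2) / real (card D)" for h
  proof -
    let ?f = "\<lambda>j. \<Sum>\<alpha>\<in>?S j. (diag_elem \<psi> A \<alpha> - Mean_GGE \<psi> D I T j A)\<^sup>2"
    \<comment> \<open>Tiles without states contribute empty sums, so only the finitely many occupied
      ones remain.\<close>
    have "(\<Sum>\<^sub>\<infinity>j\<in>J. ?f j) = (\<Sum>\<^sub>\<infinity>j\<in>cell ` D. ?f j)"
    proof (rule infsum_cong_neutral)
      fix j assume "j \<in> J - cell ` D"
      hence "{\<alpha>\<in>D. cell \<alpha> = j} = {}" "j \<in> J" by blast+
      hence "?S j = {}" using S by simp
      thus "?f j = 0" by (simp only: sum.empty)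
    qed (use cell in auto)
    also have "\<dots> = (\<Sum>j\<in>cell ` D. ?f j)"
      using assms by simp
    also have "\<dots> \<le> (\<Sum>j\<in>cell ` D. \<Sum>\<alpha>\<in>?S j. (diag_elem \<psi> A \<alpha> - h j)\<^sup>2)"
      unfolding Mean_GGE_def using assms by (intro sum_mono sum_squares_mean_minimal) simp
    also have "\<dots> = (\<Sum>j\<in>cell ` D. \<Sum>\<alpha>\<in>{\<alpha>\<in>D. cell \<alpha> = j}. (diag_elem \<psi> A \<alpha> - h (cell \<alpha>))\<^sup>2)"
    proof (rule sum.cong[OF refl])
      fix j assume "j \<in> cell ` D"
      hence "j \<in> J" using cell by blast
      thus "(\<Sum>\<alpha>\<in>?S j. (diag_elem \<psi> A \<alpha> - h j)\<^sup>2)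
          = (\<Sum>\<alpha>\<in>{\<alpha>\<in>D. cell \<alpha> = j}. (diag_elem \<psi> A \<alpha> - h (cell \<alpha>))\<^sup>2)"
        by (intro sum.cong) (simp_all add: S)
    qed
    also have "\<dots> = (\<Sum>\<alpha>\<in>D. (diag_elem \<psi> A \<alpha> - h (cell \<alpha>))\<^sup>2)"
      using assms by (intro sum.image_gen[symmetric])
    finally show ?thesis
      unfolding Var_GGE_def by (simp add: divide_right_mono)
  qed
  with cell that show thesis by blast
qed

section \<open>Euclidean estimate of the perturbed projection residual\<close>

lemma L2_set_power2: "(L2_set f S)\<^sup>2 = (\<Sum>\<alpha>\<in>S. (f \<alpha>)\<^sup>2)"
  by (simp add: L2_set_def sum_nonneg)

text \<open>Here \<open>d\<close> is the error of replacing \<open>w\<close> by a tilewise constant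
  vector \<open>w - d\<close>. Degenerate cases are included: if \<open>u\<close> or
  \<open>w\<close> vanishes on \<open>D\<close>, then \<open>p\<close>, \<open>c\<close> and
  \<open>cos \<theta>\<close> are all 0.\<close>

lemma projection_residual_bound:
  fixes u w d :: "'i \<Rightarrow> real" and \<Delta> :: real
  assumes "finite D" and \<Delta>: "\<Delta> \<ge> 0" "\<And>\<alpha>. \<alpha> \<in> D \<Longrightarrow> \<bar>d \<alpha>\<bar> \<le> \<Delta>"
  defines "p \<equiv> \<Sum>\<alpha>\<in>D. w \<alpha> * u \<alpha>"
  defines "\<theta> \<equiv> arccos (p / (L2_set w D * L2_set u D))"
    and "c \<equiv> p / (L2_set w D)\<^sup>2"
    and "\<epsilon> \<equiv> \<Delta> / sqrt ((L2_set w D)\<^sup>2 / real (card D))"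
  shows "(\<Sum>\<alpha>\<in>D. (u \<alpha> - c * w \<alpha> + c * d \<alpha>)\<^sup>2)
    \<le> (L2_set u D)\<^sup>2 * ((sin \<theta>)\<^sup>2 + \<bar>cos \<theta>\<bar> * (2 * \<epsilon> + \<epsilon>\<^sup>2))"
proof -
  let ?u = "L2_set u D" and ?w = "L2_set w D"
  define \<rho> where "\<rho> = p / (?w * ?u)"
  have CS: "\<bar>p\<bar> \<le> ?w * ?u"
    unfolding p_def
    using L2_set_mult_ineq[of w u D] sum_abs[of "\<lambda>\<alpha>. w \<alpha> * u \<alpha>" D] by (simp add: abs_mult)
  have \<rho>1: "\<bar>\<rho>\<bar> \<le> 1"
  proof -
    have "\<bar>\<rho>\<bar> = \<bar>p\<bar> / (?w * ?u)"
      by (simp add: \<rho>_def abs_mult L2_set_nonneg)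
    also have "\<dots> \<le> 1"
      using CS by (intro divide_le_eq_1[THEN iffD2]) linarith
    finally show ?thesis .
  qed
  \<comment> \<open>If the product of norms is 0, Cauchy-Schwarz forces
    \<open>p = 0\<close>.\<close>
  have p: "p = \<rho> * ?w * ?u"
    using CS by (cases "?w * ?u = 0") (auto simp: \<rho>_def)
  have cos: "cos \<theta> = \<rho>"
    unfolding \<theta>_def using \<rho>1 by (simp add: cos_arccos_abs flip: \<rho>_def)
  have sin: "(sin \<theta>)\<^sup>2 = 1 - \<rho>\<^sup>2"
    using cos by (simp add: sin_squared_eq)
  have c: "c * ?w = \<rho> * ?u"
    using p by (cases "?w = 0") (auto simp: c_def \<rho>_def power2_eq_square)
  have cp: "c * p = (\<rho> * ?u)\<^sup>2"
    using p c by (metis (no_types, opaque_lifting) mult.assoc mult.commute power2_eq_square)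
  \<comment> \<open>Pythagoras: \<open>c * p\<close> and \<open>(c * ?w)\<^sup>2\<close> both equal
    \<open>(\<rho> * ?u)\<^sup>2\<close>, so a single copy is subtracted from
    \<open>?u\<^sup>2\<close>.\<close>
  have "(L2_set (\<lambda>\<alpha>. u \<alpha> - c * w \<alpha>) D)\<^sup>2 = (\<Sum>\<alpha>\<in>D. (u \<alpha>)\<^sup>2 - 2 * c * (w \<alpha> * u \<alpha>) + c\<^sup>2 * (w \<alpha>)\<^sup>2)"
    unfolding L2_set_power2 by (intro sum.cong refl) (simp add: power2_eq_square algebra_simps)
  also have "\<dots> = ?u\<^sup>2 - 2 * c * p + (c * ?w)\<^sup>2"
    by (simp add: L2_set_power2 p_def sum.distrib sum_subtractf power_mult_distrib
        flip: sum_distrib_left)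
  also have "\<dots> = (?u * \<bar>sin \<theta>\<bar>)\<^sup>2"
    using c cp by (simp add: sin power_mult_distrib algebra_simps)
  finally have "(L2_set (\<lambda>\<alpha>. u \<alpha> - c * w \<alpha>) D)\<^sup>2 = (?u * \<bar>sin \<theta>\<bar>)\<^sup>2" .
  hence residual: "L2_set (\<lambda>\<alpha>. u \<alpha> - c * w \<alpha>) D = ?u * \<bar>sin \<theta>\<bar>"
    by (simp add: L2_set_nonneg power2_eq_iff_nonneg)
  have "(L2_set d D)\<^sup>2 \<le> (\<Sum>\<alpha>\<in>D. \<Delta>\<^sup>2)"
    unfolding L2_set_power2 using \<Delta> by (intro sum_mono) (metis abs_ge_zero power2_abs power_mono)
  also have "\<dots> = (sqrt (real (card D)) * \<Delta>)\<^sup>2"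
    by (simp add: power_mult_distrib)
  finally have d: "L2_set d D \<le> sqrt (real (card D)) * \<Delta>"
    by (rule power2_le_imp_le) (use \<Delta> in simp)
  have "L2_set (\<lambda>\<alpha>. c * d \<alpha>) D = \<bar>c\<bar> * L2_set d D"
    by (simp add: L2_set_def power_mult_distrib real_sqrt_mult flip: sum_distrib_left)
  also have "\<dots> \<le> \<bar>c\<bar> * (sqrt (real (card D)) * \<Delta>)"
    using d by (intro mult_left_mono) auto
  \<comment> \<open>The factor \<open>sqrt (real (card D))\<close> is absorbed because \<epsilon> is
    normalised by the standard deviation \<open>?w / sqrt (real (card D))\<close>; for
    \<open>?w = 0\<close> also \<open>c = 0\<close>.\<close>
  also have "\<dots> = \<bar>c * ?w\<bar> * \<epsilon>"
    by (cases "?w = 0")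
      (auto simp: c_def \<epsilon>_def real_sqrt_divide abs_mult L2_set_nonneg field_simps)
  also have "\<dots> = ?u * (\<bar>cos \<theta>\<bar> * \<epsilon>)"
    by (simp add: c cos abs_mult L2_set_nonneg)
  finally have shift: "L2_set (\<lambda>\<alpha>. c * d \<alpha>) D \<le> ?u * (\<bar>cos \<theta>\<bar> * \<epsilon>)" .
  have "L2_set (\<lambda>\<alpha>. u \<alpha> - c * w \<alpha> + c * d \<alpha>) D \<le> ?u * (\<bar>sin \<theta>\<bar> + \<bar>cos \<theta>\<bar> * \<epsilon>)"
    using L2_set_triangle_ineq[of "\<lambda>\<alpha>. u \<alpha> - c * w \<alpha>" "\<lambda>\<alpha>. c * d \<alpha>" D] residual shift
    by (simp add: distrib_left)
  hence "(L2_set (\<lambda>\<alpha>. u \<alpha> - c * w \<alpha> + c * d \<alpha>) D)\<^sup>2 \<le> ?u\<^sup>2 * (\<bar>sin \<theta>\<bar> + \<bar>cos \<theta>\<bar> * \<epsilon>)\<^sup>2"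
    unfolding power_mult_distrib[symmetric] by (intro power_mono L2_set_nonneg)
  also have "(\<bar>sin \<theta>\<bar> + \<bar>cos \<theta>\<bar> * \<epsilon>)\<^sup>2
      = (sin \<theta>)\<^sup>2 + \<bar>cos \<theta>\<bar> * (2 * (\<bar>sin \<theta>\<bar> * \<epsilon>) + \<bar>cos \<theta>\<bar> * \<epsilon>\<^sup>2)"
    by (simp add: power2_sum power_mult_distrib algebra_simps power2_eq_square)
  \<comment> \<open>Both correction terms carry a factor \<open>\<bar>cos \<theta>\<bar>\<close>.
    Bounding the remaining sine and cosine by 1 leaves a function of \<epsilon> alone.\<close>
  also have "?u\<^sup>2 * \<dots> \<le> ?u\<^sup>2 * ((sin \<theta>)\<^sup>2 + \<bar>cos \<theta>\<bar> * (2 * \<epsilon> + \<epsilon>\<^sup>2))"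
  proof -
    have "\<epsilon> \<ge> 0" unfolding \<epsilon>_def using \<Delta> by simp
    hence "\<bar>sin \<theta>\<bar> * \<epsilon> \<le> \<epsilon>" "\<bar>cos \<theta>\<bar> * \<epsilon>\<^sup>2 \<le> \<epsilon>\<^sup>2"
      by (intro mult_left_le_one_le; simp)+
    thus ?thesis
      by (intro mult_left_mono add_left_mono add_mono) auto
  qed
  finally show ?thesis
    by (simp only: L2_set_power2)
qed

text \<open>The order symbol is read as a function \<open>g\<close> chosen before all physical data,
  hence uniform in them. If \<open>Var_MC \<psi> D I\<close> is 0, the quotient is 0 and so is
  \<open>cos \<theta>\<close>, and the bound is \<open>Var_MC \<psi> D A\<close> itself.\<close>

theorem mainTheorem1:
  "\<exists>g :: real \<Rightarrow> real. g \<in> O[at_right 0](\<lambda>\<epsilon>. \<epsilon>) \<and>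
     (\<forall>(V :: 'a::complex_inner set) H (K :: 'i set) \<psi> E W D A I J b T.
        hamiltonian V H \<longrightarrow>
        orthonormal_eigenstates V H K \<psi> E \<longrightarrow>
        is_interval W \<longrightarrow>
        D = {\<alpha>\<in>K. E \<alpha> \<in> W} \<longrightarrow>
        finite D \<longrightarrow>
        D \<noteq> {} \<longrightarrow>
        observable \<psi> D A \<longrightarrow>
        integral_of_motion \<psi> D I \<longrightarrow>
        tiling J b T (diag_elem \<psi> I ` D) \<longrightarrow>
        bdd_above ((\<lambda>j. b (j + 1) - b j) ` J) \<longrightarrow>
        (let \<theta> = hs_angle \<psi> D (traceless \<psi> D I) (diag_part \<psi> D (traceless \<psi> D A));
             \<Delta>I = max_width J b
         in Var_GGE \<psi> D I J T A
              \<le> Var_MC \<psi> D A * ((sin \<theta>)\<^sup>2 + \<bar>cos \<theta>\<bar> * g (\<Delta>I / sqrt (Var_MC \<psi> D I)))))"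
proof (intro exI conjI allI impI)
  have "(\<lambda>\<epsilon>::real. \<epsilon>\<^sup>2) \<in> O[at_right 0](\<lambda>\<epsilon>. \<epsilon>)"
  proof (rule bigoI)
    have "\<forall>\<^sub>F \<epsilon> in at_right (0::real). \<epsilon> \<in> {0<..<1}"
      by (rule eventually_at_right_real) simp
    thus "\<forall>\<^sub>F \<epsilon> in at_right (0::real). norm (\<epsilon>\<^sup>2) \<le> 1 * norm \<epsilon>"
      by eventually_elim (simp add: power2_eq_square mult_left_le_one_le)
  qed
  \<comment> \<open>This fixes the witness for \<open>g\<close>, which \<open>exI\<close> left
    schematic.\<close>
  thus "(\<lambda>\<epsilon>::real. 2 * \<epsilon> + \<epsilon>\<^sup>2) \<in> O[at_right 0](\<lambda>\<epsilon>. \<epsilon>)"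
    by (intro sum_in_bigo) simp_all
next
  fix V :: "'a set" and H :: "'a \<Rightarrow> 'a" and K :: "'i set" and \<psi> E W D A I J b T
  assume orth: "orthonormal_eigenstates V H K \<psi> E" and D: "D = {\<alpha>\<in>K. E \<alpha> \<in> W}"
    and fin: "finite D" and ne: "D \<noteq> {}" and A: "observable \<psi> D A"
    and I: "integral_of_motion \<psi> D I" and tiling: "tiling J b T (diag_elem \<psi> I ` D)"
    and bdd: "bdd_above ((\<lambda>j. b (j + 1) - b j) ` J)"
  interpret orthonormal_window \<psi> D
    using fin orth D by unfold_locales (auto simp: orthonormal_eigenstates_def)
  define \<mu> where "\<mu> = Mean_MC \<psi> D I"
  define u where "u = (\<lambda>\<alpha>. diag_elem \<psi> A \<alpha> - Mean_MC \<psi> D A)"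
  define w where "w = (\<lambda>\<alpha>. diag_elem \<psi> I \<alpha> - \<mu>)"
  define c where "c = (\<Sum>\<alpha>\<in>D. w \<alpha> * u \<alpha>) / (L2_set w D)\<^sup>2"
  define \<theta> where "\<theta> = arccos ((\<Sum>\<alpha>\<in>D. w \<alpha> * u \<alpha>) / (L2_set w D * L2_set u D))"
  define \<Delta> where "\<Delta> = max_width J b"
  have varA: "Var_MC \<psi> D A = (L2_set u D)\<^sup>2 / real (card D)"
    by (simp add: Var_MC_def L2_set_power2 u_def)
  have varI: "Var_MC \<psi> D I = (L2_set w D)\<^sup>2 / real (card D)"
    by (simp add: Var_MC_def L2_set_power2 w_def \<mu>_def)
  have angle: "hs_angle \<psi> D (traceless \<psi> D I) (diag_part \<psi> D (traceless \<psi> D A)) = \<theta>"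
    unfolding \<theta>_def u_def w_def \<mu>_def by (rule hs_angle_integral_of_motion[OF A I])
  obtain cell where cell: "\<And>\<alpha>. \<alpha> \<in> D \<Longrightarrow> cell \<alpha> \<in> J \<and> diag_elem \<psi> I \<alpha> \<in> T (cell \<alpha>)"
    and var_le: "\<And>h. Var_GGE \<psi> D I J T A
        \<le> (\<Sum>\<alpha>\<in>D. (diag_elem \<psi> A \<alpha> - h (cell \<alpha>))\<^sup>2) / real (card D)"
    using Var_GGE_le_tilewise_constant[OF fin tiling, where A = A] by metis
  \<comment> \<open>The offset of a state from the left endpoint of its tile, hence between 0 and
    the tile width.\<close>
  define d where "d = (\<lambda>\<alpha>. diag_elem \<psi> I \<alpha> - b (cell \<alpha>))"
  have width: "b (j + 1) - b j \<le> \<Delta>" if "j \<in> J" for j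
    unfolding \<Delta>_def max_width_def using that bdd by (rule cSUP_upper)
  have d: "\<bar>d \<alpha>\<bar> \<le> \<Delta>" if "\<alpha> \<in> D" for \<alpha>
  proof -
    have "diag_elem \<psi> I \<alpha> \<in> {b (cell \<alpha>)..b (cell \<alpha> + 1)}"
      using cell[OF that] tiling unfolding tiling_def by blast
    thus ?thesis
      using width[of "cell \<alpha>"] cell[OF that] by (simp add: d_def)
  qed
  \<comment> \<open>Any state in \<open>D\<close> gives an absolute value below \<Delta>.\<close>
  have "\<Delta> \<ge> 0"
    using ne d by (meson abs_ge_zero all_not_in_conv order_trans)
  \<comment> \<open>The choice of \<open>h\<close> is the linear regression of the diagonal elements
    of \<open>A\<close> on those of \<open>I\<close>, evaluated at the left endpoint of each
    tile.\<close>
  have "Var_GGE \<psi> D I J T A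
      \<le> (\<Sum>\<alpha>\<in>D. (diag_elem \<psi> A \<alpha> - (Mean_MC \<psi> D A + c * (b (cell \<alpha>) - \<mu>)))\<^sup>2) / real (card D)"
    by (rule var_le)
  also have "\<dots> = (\<Sum>\<alpha>\<in>D. (u \<alpha> - c * w \<alpha> + c * d \<alpha>)\<^sup>2) / real (card D)"
    by (simp add: u_def w_def d_def algebra_simps)
  also have "\<dots> \<le> (L2_set u D)\<^sup>2 * ((sin \<theta>)\<^sup>2 + \<bar>cos \<theta>\<bar>
      * (2 * (\<Delta> / sqrt (Var_MC \<psi> D I)) + (\<Delta> / sqrt (Var_MC \<psi> D I))\<^sup>2)) / real (card D)"
    unfolding varI c_def \<theta>_def
    by (intro divide_right_mono projection_residual_bound fin \<open>\<Delta> \<ge> 0\<close> d) auto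
  finally show "let \<theta> = hs_angle \<psi> D (traceless \<psi> D I) (diag_part \<psi> D (traceless \<psi> D A));
             \<Delta>I = max_width J b
         in Var_GGE \<psi> D I J T A
              \<le> Var_MC \<psi> D A * ((sin \<theta>)\<^sup>2 + \<bar>cos \<theta>\<bar>
                * (2 * (\<Delta>I / sqrt (Var_MC \<psi> D I)) + (\<Delta>I / sqrt (Var_MC \<psi> D I))\<^sup>2))"
    unfolding Let_def angle varA by (simp add: \<Delta>_def)
qed

end
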